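(* Let $h$ and $k$ be integers with $4\le h\le k-1$. Let $A=\{a_1,a_2,\ldots,a_k\}$ be a set of $k$ positive integers with $a_1<a_2<\cdots<a_k$. Let $A_{h+1}=\{a_1,\ldots,a_{h+1}\}$ and $A'=A\setminus\{a_1\}$. Suppose that $\left|h^{\wedge}_{\pm}A\right|=2hk-h^2+1$ and that one of the following conditions holds: (a) $A$ is an arithmetic progression; (b) $A_{h+1}$ is an arithmetic progression; (c) $\left|h^{\wedge}_{\pm}A_{h+1}\right|\ge (h+1)^2$ and $4\le h\le k-3$; (d) $h^{\wedge}_{\pm}A=h^{\wedge}(-A')\cup h^{\wedge}_{\pm}A_{h+1}\cup h^{\wedge}A'$ and $A'$ is an arithmetic progression; (e) $\left|h^{\wedge}_{\pm}A_{h+1}\right|\ge (h+1)^2$ and $A'$ is an arithmetic progression. Then $A=a_1\ast\{1,3,5,\ldots,2k-1\}$.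
   Context: For a positive integer $h$ and a finite set of integers $A=\{a_1,\ldots,a_k\}$ (distinct elements), the restricted $h$-fold signed sumset is $h^{\wedge}_{\pm}A=\left\{\sum_{i=1}^k\lambda_i a_i:\lambda_i\in\{-1,0,1\},\ \sum_{i=1}^k|\lambda_i|=h\right\}$, and the restricted $h$-fold sumset is $h^{\wedge}A=\left\{\sum_{i=1}^k\lambda_i a_i:\lambda_i\in\{0,1\},\ \sum_{i=1}^k\lambda_i=h\right\}$. For a set $S$ of integers, $-S=\{-s:s\in S\}$ and $c\ast S=\{cs:s\in S\}$ for an integer $c$. *)

theory Defs
  imports Main
begin

text \<open>The coefficients are indexed by the elements of \<open>A\<close> themselves; both definitions are meant
  for finite \<open>A\<close>, since sums over infinite sets are \<open>0\<close>.\<close>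

definition restricted_signed_sumset :: "nat \<Rightarrow> int set \<Rightarrow> int set" where
  "restricted_signed_sumset h A =
     {\<Sum>a\<in>A. l a * a | l :: int \<Rightarrow> int.
        (\<forall>a\<in>A. l a \<in> {-1, 0, 1}) \<and> (\<Sum>a\<in>A. \<bar>l a\<bar>) = int h}"

definition restricted_sumset :: "nat \<Rightarrow> int set \<Rightarrow> int set" where
  "restricted_sumset h A =
     {\<Sum>a\<in>A. l a * a | l :: int \<Rightarrow> int.
        (\<forall>a\<in>A. l a \<in> {0, 1}) \<and> (\<Sum>a\<in>A. l a) = int h}"

definition dilate :: "int \<Rightarrow> int set \<Rightarrow> int set" where
  "dilate c S = {c * s | s. s \<in> S}"

text \<open>Finite arithmetic progressions, as sets. Requiring \<open>d > 0\<close> excludes nothing: a negative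
  difference reverses the progression, and \<open>d = 0\<close> only gives singletons.\<close>

definition arithmetic_progression :: "int set \<Rightarrow> bool" where
  "arithmetic_progression S \<longleftrightarrow>
     (\<exists>c d. \<exists>n::nat. d > 0 \<and> S = {c + int i * d | i. i < n})"

end

theory Submission
  imports Defs
begin

text \<open>Write \<open>S\<close> for the signed sumset of \<open>A\<close> and \<open>t\<^sub>i = a\<^sub>i\<^sub>+\<^sub>1 + \<dots> + a\<^sub>i\<^sub>+\<^sub>h\<close>. Since
  \<open>S = - S\<close>, each of the intervals \<open>(t\<^sub>i, t\<^sub>i\<^sub>+\<^sub>1]\<close> with \<open>1 \<le> i < k - h\<close> and its mirror image contains
  at least \<open>h\<close> elements of \<open>S\<close>, and \<open>[-t\<^sub>1, t\<^sub>1]\<close> contains the signed sumset of \<open>A\<^sub>h\<close>. If the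
  latter has at least \<open>(h + 1)\<^sup>2\<close> elements, the cardinality assumption makes all these bounds sharp.
  Sharpness in two consecutive intervals says that \<open>h + 2\<close> consecutive elements of \<open>A'\<close> have the
  minimal number of pairwise sums, so they form an arithmetic progression. It remains to treat
  \<open>h + 1\<close> elements \<open>a < b < b + d < \<dots>\<close>: splitting at the sums obtained by changing the signs of the
  smallest elements one after the other shows that they always have at least \<open>(h + 1)\<^sup>2\<close> signed
  sums, and more unless \<open>b = 3 a\<close> and \<open>d = 2 a\<close>.\<close>

section \<open>Elementary properties of signed sumsets\<close>

lemma uminus_restricted_signed_sumset:
  assumes "s \<in> restricted_signed_sumset h A"
  shows "- s \<in> restricted_signed_sumset h A"
proof -
  obtain l where l: "s = (\<Sum>a\<in>A. l a * a)" "\<forall>a\<in>A. l a \<in> {-1, 0, 1}" "(\<Sum>a\<in>A. \<bar>l a\<bar>) = int h"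
    using assms unfolding restricted_signed_sumset_def by blast
  have "- s = (\<Sum>a\<in>A. (- l a) * a)"
    unfolding l(1) by (simp add: sum_negf)
  moreover have "\<forall>a\<in>A. - l a \<in> {-1, 0, 1}" "(\<Sum>a\<in>A. \<bar>- l a\<bar>) = int h"
    using l by auto
  ultimately show ?thesis
    unfolding restricted_signed_sumset_def by (intro CollectI exI[of _ "\<lambda>a. - l a"]) auto
qed

lemma finite_restricted_signed_sumset: "finite (restricted_signed_sumset h A)"
proof -
  have "restricted_signed_sumset h A \<subseteq> {- (\<Sum>a\<in>A. \<bar>a\<bar>)..(\<Sum>a\<in>A. \<bar>a\<bar>)}"
  proof
    fix s assume "s \<in> restricted_signed_sumset h A"
    then obtain l where l: "s = (\<Sum>a\<in>A. l a * a)" "\<forall>a\<in>A. l a \<in> {-1, 0, 1}"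
      unfolding restricted_signed_sumset_def by blast
    have "\<bar>s\<bar> \<le> (\<Sum>a\<in>A. \<bar>l a * a\<bar>)"
      unfolding l(1) by (rule sum_abs)
    also have "\<dots> \<le> (\<Sum>a\<in>A. \<bar>a\<bar>)"
      by (rule sum_mono) (use l(2) in \<open>fastforce simp: abs_mult\<close>)
    finally show "s \<in> {- (\<Sum>a\<in>A. \<bar>a\<bar>)..(\<Sum>a\<in>A. \<bar>a\<bar>)}" by auto
  qed
  then show ?thesis by (rule finite_subset) simp
qed

text \<open>Coefficients are indexed by values, whereas later sums are chosen by indices:
  \<open>X\<close> carries the plus signs and \<open>Y\<close> the minus signs. Injectivity of
  \<open>a\<close> on \<open>I\<close> makes the sign of a value well defined.\<close>

lemma restricted_signed_sumsetI:
  fixes a :: "nat \<Rightarrow> int"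
  assumes "finite I" "inj_on a I" "X \<subseteq> I" "Y \<subseteq> I" "X \<inter> Y = {}" "card X + card Y = h"
  shows "sum a X - sum a Y \<in> restricted_signed_sumset h (a ` I)"
proof -
  define c where "c i = (if i \<in> X then 1 else if i \<in> Y then - 1 else 0 :: int)" for i
  define l where "l v = c (the_inv_into I a v)" for v
  have l: "l (a i) = c i" if "i \<in> I" for i
    using that assms(2) by (simp add: l_def the_inv_into_f_f)
  have fin: "finite X" "finite Y" using assms finite_subset by blast+
  have split: "sum f I = sum f X + sum f Y" if "\<And>i. i \<in> I - (X \<union> Y) \<Longrightarrow> f i = 0" for f :: "nat \<Rightarrow> int"
  proof -
    have "sum f I = sum f (X \<union> Y)"
      by (rule sum.mono_neutral_right) (use assms that in auto)
    then show ?thesis using fin assms(5) by (simp add: sum.union_disjoint)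
  qed
  have "(\<Sum>v\<in>a ` I. l v * v) = (\<Sum>i\<in>I. c i * a i)"
    using assms(2) by (simp add: sum.reindex l)
  also have "\<dots> = (\<Sum>i\<in>X. c i * a i) + (\<Sum>i\<in>Y. c i * a i)"
    by (rule split) (auto simp: c_def)
  also have "(\<Sum>i\<in>X. c i * a i) = sum a X" by (rule sum.cong) (auto simp: c_def)
  also have "(\<Sum>i\<in>Y. c i * a i) = - sum a Y"
    unfolding sum_negf[symmetric] by (rule sum.cong) (use assms(5) in \<open>auto simp: c_def\<close>)
  finally have 1: "sum a X - sum a Y = (\<Sum>v\<in>a ` I. l v * v)" by simp
  have "(\<Sum>v\<in>a ` I. \<bar>l v\<bar>) = (\<Sum>i\<in>I. \<bar>c i\<bar>)"
    using assms(2) by (simp add: sum.reindex l)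
  also have "\<dots> = (\<Sum>i\<in>X. \<bar>c i\<bar>) + (\<Sum>i\<in>Y. \<bar>c i\<bar>)"
    by (rule split) (auto simp: c_def)
  also have "(\<Sum>i\<in>X. \<bar>c i\<bar>) = (\<Sum>i\<in>X. 1)" by (rule sum.cong) (auto simp: c_def)
  also have "(\<Sum>i\<in>Y. \<bar>c i\<bar>) = (\<Sum>i\<in>Y. 1)"
    by (rule sum.cong) (use assms(5) in \<open>auto simp: c_def\<close>)
  finally have 2: "(\<Sum>v\<in>a ` I. \<bar>l v\<bar>) = int h"
    using assms(6) by simp
  have "\<forall>v\<in>a ` I. l v \<in> {-1, 0, 1}" by (auto simp: l c_def)
  with 1 2 show ?thesis unfolding restricted_signed_sumset_def by blast
qed

lemma restricted_signed_sumset_mono: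
  assumes "finite B" "A \<subseteq> B"
  shows "restricted_signed_sumset h A \<subseteq> restricted_signed_sumset h B"
proof
  fix s assume "s \<in> restricted_signed_sumset h A"
  then obtain l where l: "s = (\<Sum>a\<in>A. l a * a)" "\<forall>a\<in>A. l a \<in> {-1, 0, 1}" "(\<Sum>a\<in>A. \<bar>l a\<bar>) = int h"
    unfolding restricted_signed_sumset_def by blast
  define l' where "l' v = (if v \<in> A then l v else 0)" for v
  have "sum f B = sum f A" if "\<And>v. v \<notin> A \<Longrightarrow> f v = 0" for f :: "int \<Rightarrow> int"
    using assms that by (intro sum.mono_neutral_right) auto
  from this[of "\<lambda>v. l' v * v"] this[of "\<lambda>v. \<bar>l' v\<bar>"] have "s = (\<Sum>a\<in>B. l' a * a)" "(\<Sum>a\<in>B. \<bar>l' a\<bar>) = int h"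
    using l by (simp_all add: l'_def)
  moreover have "\<forall>a\<in>B. l' a \<in> {-1, 0, 1}" using l by (simp add: l'_def)
  ultimately show "s \<in> restricted_signed_sumset h B"
    unfolding restricted_signed_sumset_def by blast
qed

text \<open>Exactly one of the \<open>h + 1\<close> coefficients vanishes, so one element, worth at
  least \<open>m\<close>, is missing. The weight \<open>1 - \<bar>l a\<bar>\<close> in the termwise
  bound is 1 exactly at that element.\<close>

lemma abs_restricted_signed_sumset_le:
  assumes "s \<in> restricted_signed_sumset h A" "finite A" "card A = h + 1"
    and m: "m \<ge> 0" "\<And>v. v \<in> A \<Longrightarrow> m \<le> v"
  shows "\<bar>s\<bar> \<le> \<Sum>A - m"
proof -
  obtain l where l: "s = (\<Sum>a\<in>A. l a * a)" "\<forall>a\<in>A. l a \<in> {-1, 0, 1}" "(\<Sum>a\<in>A. \<bar>l a\<bar>) = int h"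
    using assms unfolding restricted_signed_sumset_def by blast
  have "\<bar>s\<bar> \<le> (\<Sum>a\<in>A. \<bar>l a * a\<bar>)"
    unfolding l(1) by (rule sum_abs)
  also have "\<dots> \<le> (\<Sum>a\<in>A. a - m * (1 - \<bar>l a\<bar>))"
    by (rule sum_mono) (use l(2) m in \<open>fastforce simp: abs_mult\<close>)
  also have "\<dots> = \<Sum>A - m * (\<Sum>a\<in>A. 1 - \<bar>l a\<bar>)"
    by (simp only: sum_subtractf[of "\<lambda>a. a"] sum_distrib_left)
  also have "(\<Sum>a\<in>A. 1 - \<bar>l a\<bar>) = 1"
    using l(3) assms(3) by (simp add: sum_subtractf)
  finally show ?thesis by simp
qed

text \<open>Modulo \<open>2 * c\<close> an odd multiple of \<open>c\<close> and its negative are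
  both congruent to \<open>c\<close>, so only the number of nonzero coefficients matters. In
  \<open>next_element\<close> this rules out a last element that is too small.\<close>

lemma restricted_signed_sumset_odd_multiples:
  assumes "s \<in> restricted_signed_sumset h A" and odd: "\<And>v. v \<in> A \<Longrightarrow> \<exists>n. v = (2 * n - 1) * c"
  shows "2 * c dvd s - c * int h"
proof -
  obtain l where l: "s = (\<Sum>a\<in>A. l a * a)" "\<forall>a\<in>A. l a \<in> {-1, 0, 1}" "(\<Sum>a\<in>A. \<bar>l a\<bar>) = int h"
    using assms unfolding restricted_signed_sumset_def by blast
  have "s - c * int h = (\<Sum>v\<in>A. l v * v - c * \<bar>l v\<bar>)"
    unfolding l(1) l(3)[symmetric] by (simp add: sum_subtractf sum_distrib_left)
  also have "2 * c dvd \<dots>"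
  proof (rule dvd_sum)
    fix v assume v: "v \<in> A"
    then obtain n where n: "v = (2 * n - 1) * c" using odd by blast
    have "l v = -1 \<or> l v = 0 \<or> l v = 1" using l(2) v by auto
    then have "l v * v - c * \<bar>l v\<bar> = 2 * c * (if l v = - 1 then - n else if l v = 0 then 0 else n - 1)"
      unfolding n by (auto simp: algebra_simps)
    then show "2 * c dvd l v * v - c * \<bar>l v\<bar>" by simp
  qed
  finally show ?thesis .
qed

section \<open>Counting the signed sums of a head followed by a progression\<close>

lemma sum_card_atLeastLessThan_le:
  fixes f :: "nat \<Rightarrow> int"
  assumes "finite R" "\<And>r. r < n \<Longrightarrow> f r \<le> f (Suc r)"
  shows "(\<Sum>r<n. card (R \<inter> {f r..<f (Suc r)})) + card (R \<inter> {f n..}) = card (R \<inter> {f 0..})"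
  using assms(2)
proof (induction n)
  case (Suc n)
  have "R \<inter> {f n..} = (R \<inter> {f n..<f (Suc n)}) \<union> (R \<inter> {f (Suc n)..})"
    using Suc.prems[of n] by force
  then have "card (R \<inter> {f n..}) = card (R \<inter> {f n..<f (Suc n)}) + card (R \<inter> {f (Suc n)..})"
    using assms(1) by (simp add: card_Un_disjoint disjoint_iff)
  with Suc show ?case by simp
qed simp

text \<open>A sum of all but one of the \<open>h + 1\<close> terms, with signs, is the total minus the omitted term
  minus twice the terms with negative sign; this is the set of what is subtracted.\<close>

definition sign_deficits :: "nat \<Rightarrow> (nat \<Rightarrow> int) \<Rightarrow> int set" where
  "sign_deficits h x = {x j + 2 * sum x Y | j Y. j \<le> h \<and> Y \<subseteq> {..h} - {j}}"

lemma sign_deficitsI: "j \<le> h \<Longrightarrow> Y \<subseteq> {..h} - {j} \<Longrightarrow> v = x j + 2 * sum x Y \<Longrightarrow> v \<in> sign_deficits h x"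
  unfolding sign_deficits_def by blast

lemma finite_sign_deficits: "finite (sign_deficits h x)"
proof -
  have "sign_deficits h x \<subseteq> (\<lambda>(j, Y). x j + 2 * sum x Y) ` ({..h} \<times> Pow {..h})"
    unfolding sign_deficits_def by auto
  then show ?thesis by (rule finite_subset) simp
qed

text \<open>\<open>sum x {..h} - v\<close> is the signed sum that omits \<open>j\<close>, gives
  \<open>Y\<close> the minus sign and every other index the plus sign; subtraction from a constant
  is injective.\<close>

lemma card_sign_deficits_le:
  assumes "inj_on x {..h}"
  shows "card (sign_deficits h x) \<le> card (restricted_signed_sumset h (x ` {..h}))"
proof (rule card_inj_on_le)
  show "inj_on (\<lambda>v. sum x {..h} - v) (sign_deficits h x)" by (auto intro: inj_onI)
  show "finite (restricted_signed_sumset h (x ` {..h}))" by (rule finite_restricted_signed_sumset)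
  show "(\<lambda>v. sum x {..h} - v) ` sign_deficits h x \<subseteq> restricted_signed_sumset h (x ` {..h})"
  proof clarify
    fix v assume "v \<in> sign_deficits h x"
    then obtain j Y where j: "j \<le> h" "Y \<subseteq> {..h} - {j}" "v = x j + 2 * sum x Y"
      unfolding sign_deficits_def by blast
    have fin: "finite Y" and jY: "j \<notin> Y" using j finite_subset by blast+
    have Y: "insert j Y \<subseteq> {..h}" using j by auto
    have "card ({..h} - insert j Y) + card (insert j Y) = h + 1"
      using Y by (metis Suc_eq_plus1 card_Diff_subset card_atMost card_mono diff_add
          finite_atMost finite_subset)
    then have card: "card ({..h} - insert j Y) + card Y = h"
      using fin jY by simp
    then have "sum x ({..h} - insert j Y) - sum x Y \<in> restricted_signed_sumset h (x ` {..h})"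
      using assms Y card by (intro restricted_signed_sumsetI) auto
    moreover have "sum x ({..h} - insert j Y) = sum x {..h} - x j - sum x Y"
      using Y fin jY by (subst sum_diff) auto
    ultimately show "sum x {..h} - v \<in> restricted_signed_sumset h (x ` {..h})"
      using j(3) by (simp add: algebra_simps)
  qed
qed


text \<open>This lemma and the two after it start from minus signs on all indices up to
  \<open>r\<close>. Here \<open>i\<close> among them is omitted; next, \<open>u\<close> beyond
  \<open>r\<close> is omitted and \<open>s\<close> is made positive; last, \<open>i\<close> is
  omitted, \<open>s\<close> is positive and \<open>u\<close> negative.\<close>

lemma sign_deficits_omit:
  assumes "i \<le> r" "r \<le> h"
  shows "2 * sum x {..r} - x i \<in> sign_deficits h x"
proof (rule sign_deficitsI)
  show "i \<le> h" "{..r} - {i} \<subseteq> {..h} - {i}" using assms by auto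
  show "2 * sum x {..r} - x i = x i + 2 * sum x ({..r} - {i})"
    using assms by (simp add: sum_diff1)
qed

lemma sign_deficits_omit_above:
  assumes "s \<le> r" "r < u" "u \<le> h"
  shows "2 * sum x {..r} + x u - 2 * x s \<in> sign_deficits h x"
proof (rule sign_deficitsI)
  show "u \<le> h" "{..r} - {s} \<subseteq> {..h} - {u}" using assms by auto
  show "2 * sum x {..r} + x u - 2 * x s = x u + 2 * sum x ({..r} - {s})"
    using assms by (simp add: sum_diff1)
qed

lemma sign_deficits_omit_swap:
  assumes "i \<le> r" "s \<le> r" "i \<noteq> s" "r < u" "u \<le> h"
  shows "2 * sum x {..r} - x i - 2 * x s + 2 * x u \<in> sign_deficits h x"
proof (rule sign_deficitsI)
  show "i \<le> h" "insert u ({..r} - {i, s}) \<subseteq> {..h} - {i}" using assms by auto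
  have "{..r} - {i, s} = {..r} - {i} - {s}" by auto
  then have "sum x ({..r} - {i, s}) = sum x {..r} - x i - x s"
    using assms by (simp add: sum_diff1)
  then show "2 * sum x {..r} - x i - 2 * x s + 2 * x u
      = x i + 2 * sum x (insert u ({..r} - {i, s}))"
    using assms by simp
qed

text \<open>The cut points \<open>f 0\<close>, ..., \<open>f h\<close> give \<open>h\<close> blocks
  and a final ray. Block \<open>r\<close> has at least \<open>2 * r + 2\<close> members and the ray
  at least \<open>h + 1\<close>, which adds up to \<open>(h + 1)\<^sup>2\<close>. The strict bound
  comes from a fifth member of block 1.\<close>

lemma card_sign_deficits_head_and_progression:
  fixes x :: "nat \<Rightarrow> int"
  assumes h: "4 \<le> h" and ab: "0 < a" "a < b" and d: "0 < d"
    and x0: "x 0 = a" and xi: "\<And>i. 1 \<le> i \<Longrightarrow> x i = b + (int i - 1) * d"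
  shows "(h + 1)\<^sup>2 \<le> card (sign_deficits h x)"
    and "b \<noteq> 3 * a \<or> d \<noteq> 2 * a \<Longrightarrow> (h + 1)\<^sup>2 < card (sign_deficits h x)"
proof -
  \<comment> \<open>\<open>f r\<close> is the deficit of the sum that omits \<open>r\<close> and has
    its minus signs exactly below \<open>r\<close>.\<close>
  define f where "f r = 2 * sum x {..<r} + x r" for r
  have f: "f r = 2 * sum x {..r} - x r" for r
    by (simp add: f_def lessThan_Suc_atMost[symmetric])
  have f_Suc: "f (Suc r) = f r + x r + x (Suc r)" for r
    by (simp add: f_def)
  have pos: "x i > 0" for i
  proof (cases "i = 0")
    case False
    then have "(int i - 1) * d \<ge> 0" using d by simp
    then show ?thesis using xi[of i] False ab by linarith
  qed (use x0 ab in simp)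
  define n where "n r = card (sign_deficits h x \<inter> {f r..<f (Suc r)})" for r
  have le_n: "card V \<le> n r" if "V \<subseteq> sign_deficits h x" "V \<subseteq> {f r..<f (Suc r)}" for V r
    unfolding n_def using that finite_sign_deficits by (intro card_mono) auto
  have x1: "x 1 = b" "x (Suc 0) = b" and x2: "x 2 = b + d" and x3: "x 3 = b + 2 * d" and x4: "x 4 = b + 3 * d"
    by (simp_all add: xi)
  have f0: "f 0 = a" and f1: "f 1 = 2 * a + b" and f2: "f 2 = 2 * a + 3 * b + d"
    by (simp_all add: f_def x0 x1 x2 numeral_2_eq_2 x2[unfolded numeral_2_eq_2])

  have "card {a, b} \<le> n 0"
  proof (rule le_n)
    have "x 0 \<in> sign_deficits h x" "x 1 \<in> sign_deficits h x"
      by (rule sign_deficitsI[where Y = "{}"]; use h in simp)+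
    then show "{a, b} \<subseteq> sign_deficits h x" by (simp add: x0 x1)
    show "{a, b} \<subseteq> {f 0..<f (Suc 0)}" using f0 f1 ab by simp
  qed
  then have n0: "2 \<le> n 0" using ab by simp

  \<comment> \<open>The offsets \<open>w\<close> from \<open>f 1\<close> are listed in the order of
    the ten instances of \<open>*\<close> below. Index 4 is available because
    \<open>4 \<le> h\<close>.\<close>
  have mem1: "2 * a + b + w \<in> sign_deficits h x"
    if "w \<in> {0, d, 2 * d, 3 * d, b - a, 2 * b + d - 2 * a, d - 2 * a, 2 * d - 2 * a,
             b - a + 2 * d, 2 * b + 2 * d - 2 * a}" for w
  proof -
    have *: "2 * a + b + w \<in> sign_deficits h x" if "j \<le> 4" "Y \<subseteq> {..4} - {j}"
      "2 * a + b + w = x j + 2 * sum x Y" for j Y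
      using that h by (intro sign_deficitsI[of j h Y]) auto
    show ?thesis
      using that *[of 1 "{0}"] *[of 2 "{0}"] *[of 3 "{0}"] *[of 4 "{0}"] *[of 0 "{1}"]
          *[of 2 "{1}"] *[of 2 "{}"] *[of 3 "{}"] *[of 0 "{2}"] *[of 1 "{2}"]
      by (auto simp: x0 x1 x2 x3 x4)
  qed
  \<comment> \<open>Block 1 has length \<open>f 2 - f 1 = 2 * b + d\<close>.\<close>
  have n1I: "card W \<le> n 1" if "W \<subseteq> {0, d, 2 * d, 3 * d, b - a, 2 * b + d - 2 * a, d - 2 * a, 2 * d - 2 * a,
             b - a + 2 * d, 2 * b + 2 * d - 2 * a}" "W \<subseteq> {0..<2 * b + d}" for W
  proof -
    have "card ((+) (2 * a + b) ` W) \<le> n 1"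
    proof (rule le_n)
      show "(+) (2 * a + b) ` W \<subseteq> sign_deficits h x" using mem1 that(1) by blast
      show "(+) (2 * a + b) ` W \<subseteq> {f 1..<f (Suc 1)}"
        using that(2) f1 f2 by (fastforce simp: numeral_2_eq_2)
    qed
    then show ?thesis by (simp add: card_image)
  qed
  \<comment> \<open>Among \<open>0\<close>, \<open>d\<close>, \<open>b - a\<close>,
    \<open>2 * b + d - 2 * a\<close> the only possible coincidence is \<open>b - a = d\<close>; then
    \<open>2 * d\<close> is taken in place of \<open>b - a\<close>.\<close>
  have n1: "4 \<le> n 1"
  proof (cases "b - a = d")
    case True
    then show ?thesis using n1I[of "{0, d, 2 * d, 2 * b + d - 2 * a}"] ab d by simp
  next
    case False
    then show ?thesis using n1I[of "{0, d, b - a, 2 * b + d - 2 * a}"] ab d by auto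
  qed
  have n1_strict: "5 \<le> n 1" if "b \<noteq> 3 * a \<or> d \<noteq> 2 * a"
  proof -
    \<comment> \<open>For \<open>2 * b \<le> d\<close> the offset \<open>2 * d\<close> leaves the
      block. Otherwise the five offsets of the second case are distinct unless
      \<open>b - a = d\<close>, \<open>b - a = 2 * d\<close> or \<open>2 * (b - a) = d\<close>, and
      these are repaired separately. Under \<open>b - a = d\<close> the value
      \<open>d = 2 * a\<close> is left out: it means \<open>b = 3 * a\<close>, which the assumption
      excludes.\<close>
    consider "2 * b \<le> d" | "2 * b > d" "b - a \<noteq> d" "b - a \<noteq> 2 * d" "2 * (b - a) \<noteq> d"
      | "b - a = 2 * d" | "b - a = d" "d < 2 * a" | "b - a = d" "2 * a < d"
      | "2 * (b - a) = d" "b > d" | "2 * (b - a) = d" "b = d" | "2 * (b - a) = d" "b < d" "d < 2 * b"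
      using \<open>b \<noteq> 3 * a \<or> d \<noteq> 2 * a\<close> ab d by linarith
    then show ?thesis
    proof cases
      case 1
      then show ?thesis using n1I[of "{0, d, b - a, 2 * b + d - 2 * a, d - 2 * a}"] ab d by auto
    next
      case 2
      then show ?thesis using n1I[of "{0, d, 2 * d, b - a, 2 * b + d - 2 * a}"] ab d by auto
    next
      case 3
      then show ?thesis using n1I[of "{0, d, 2 * d, 3 * d, 2 * b + d - 2 * a}"] ab d by auto
    next
      case 4
      then show ?thesis
        using n1I[of "{0, d, 2 * d, 2 * b + d - 2 * a, 2 * b + 2 * d - 2 * a}"] ab d by auto
    next
      case 5
      then show ?thesis
        using n1I[of "{0, d, 2 * d, 2 * b + d - 2 * a, 2 * d - 2 * a}"] ab d by auto
    next
      case 6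
      then show ?thesis
        using n1I[of "{0, d, b - a, 2 * d, 3 * d}"] ab d by auto
    next
      case 7
      then show ?thesis
        using n1I[of "{0, d, b - a, 2 * b + d - 2 * a, b - a + 2 * d}"] ab d by auto
    next
      case 8
      then show ?thesis
        using n1I[of "{0, d, b - a, 2 * b + d - 2 * a, 2 * d - 2 * a}"] ab d by auto
    qed
  qed

  have n_mid: "2 * r + 2 \<le> n r" if r: "2 \<le> r" "r < h" for r
  proof -
    have xr: "x r = b + (int r - 1) * d" "x (Suc r) = b + int r * d" using r by (simp_all add: xi)
    have fr: "f (Suc r) = f r + 2 * b + (2 * int r - 1) * d"
      by (simp add: f_Suc xr algebra_simps)
    \<comment> \<open>For odd \<open>m\<close>, \<open>Suc r\<close> is omitted and
      \<open>r - t\<close> is positive. For even \<open>m\<close>, omitting \<open>r\<close> and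
      exchanging \<open>Suc r - t\<close> for \<open>Suc r\<close> works from \<open>t = 2\<close>
      on; for \<open>t = 1\<close> it would use \<open>r\<close> twice. Then \<open>r - 2\<close> is
      omitted instead or, when \<open>r = 2\<close> and this is the head, 4 is omitted and 2 is
      positive.\<close>
    have prog: "f r + int m * d \<in> sign_deficits h x" if m: "m \<le> 2 * r" for m
    proof (cases "even m")
      case False
      then obtain t where t: "m = 2 * t + 1" by (rule oddE)
      then have "t < r" using m by simp
      then have "2 * sum x {..r} + x (Suc r) - 2 * x (r - t) \<in> sign_deficits h x"
        using r by (intro sign_deficits_omit_above) auto
      also have "2 * sum x {..r} + x (Suc r) - 2 * x (r - t) = f r + int m * d"
        using \<open>t < r\<close> by (simp add: f xr xi t of_nat_diff algebra_simps)
      finally show ?thesis .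
    next
      case True
      then obtain t where t: "m = 2 * t" by (rule evenE)
      consider "t = 0" | "t = 1" "r = 2" | "t = 1" "3 \<le> r" | "2 \<le> t" using r by linarith
      then show ?thesis
      proof cases
        case 1
        then show ?thesis using sign_deficits_omit[of r r h x] r by (simp add: f t)
      next
        case 2
        then have "2 * sum x {..2} + x 4 - 2 * x 2 \<in> sign_deficits h x"
          using h by (intro sign_deficits_omit_above) auto
        also have "2 * sum x {..2} + x 4 - 2 * x 2 = f r + int m * d"
          by (simp add: f 2 t x2 x4)
        finally show ?thesis .
      next
        case 3
        then have "2 * sum x {..r} - x (r - 2) \<in> sign_deficits h x"
          using r by (intro sign_deficits_omit) auto
        also have "2 * sum x {..r} - x (r - 2) = f r + int m * d"
          using 3 by (simp add: f xr xi t of_nat_diff algebra_simps)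
        finally show ?thesis .
      next
        case 4
        have "t \<le> r" using m t by simp
        then have "2 * sum x {..r} - x r - 2 * x (Suc r - t) + 2 * x (Suc r) \<in> sign_deficits h x"
          using r 4 by (intro sign_deficits_omit_swap) auto
        also have "2 * sum x {..r} - x r - 2 * x (Suc r - t) + 2 * x (Suc r) = f r + int m * d"
          using \<open>t \<le> r\<close> by (simp add: f xr xi t of_nat_diff algebra_simps)
        finally show ?thesis .
      qed
    qed
    \<comment> \<open>Two further members involve the head: it is omitted in \<open>head1\<close>,
      while \<open>head2\<close> omits \<open>Suc r\<close> and keeps the head positive.\<close>
    have head1: "f r + (b - a) + (int r - 1) * d \<in> sign_deficits h x"
      using sign_deficits_omit[of 0 r h x] r by (simp add: f xr x0 algebra_simps)
    have head2: "f (Suc r) - 2 * a \<in> sign_deficits h x"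
      using sign_deficits_omit_above[of 0 r "Suc r" h x] r by (simp add: f_Suc f x0 algebra_simps)
    define M where "M m = (\<lambda>i. f r + int i * d) ` {..<m}" for m :: nat
    have cardM: "card (M m) = m" for m
      using d unfolding M_def by (subst card_image) (auto intro: inj_onI)
    have finM: "finite (M m)" for m unfolding M_def by simp
    have M_le: "v \<le> f r + (int m - 1) * d" "f r \<le> v" if "v \<in> M m" for v m
      using that d by (auto simp: M_def)
    have M_dvd: "d dvd v - f r" if "v \<in> M m" for v m
      using that by (auto simp: M_def)
    have M_sub: "M m \<subseteq> sign_deficits h x" if "m \<le> 2 * r + 1" for m
      using that prog by (auto simp: M_def)
    have rd: "0 < int r * d" "2 * d \<le> int r * d" using r d by auto
    have "d \<le> (int r - 1) * d" "(2 * int r - 1) * d = 2 * ((int r - 1) * d) + d"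
      using rd by (simp_all add: algebra_simps)
    then have heads_in: "f r + (b - a) + (int r - 1) * d \<in> {f r..<f (Suc r)}"
      "f (Suc r) - 2 * a \<in> {f r..<f (Suc r)}"
      using ab d unfolding fr atLeastLessThan_iff by linarith+
    have head1_notin: "f r + (b - a) + (int r - 1) * d \<notin> M m" if "b - a < d" for m
    proof
      assume "f r + (b - a) + (int r - 1) * d \<in> M m"
      then have "d dvd (b - a) + (int r - 1) * d" using M_dvd by (fastforce simp: algebra_simps)
      then have "d dvd b - a" by (simp add: dvd_add_left_iff)
      then show False using that ab zdvd_not_zless[of "b - a" d] by auto
    qed
    \<comment> \<open>For \<open>2 * b \<le> d\<close> the last term \<open>f r + 2 * r * d\<close>
      lies outside the block, so only \<open>2 * r\<close> terms are kept and both head members are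
      added.\<close>
    show ?thesis
    proof (cases "2 * b \<le> d")
      case True
      let ?V = "insert (f r + (b - a) + (int r - 1) * d) (insert (f (Suc r) - 2 * a) (M (2 * r)))"
      have "f (Suc r) - 2 * a \<notin> M (2 * r)"
        using M_le(1)[of "f (Suc r) - 2 * a" "2 * r"] ab unfolding fr by auto
      moreover have "f r + (b - a) + (int r - 1) * d \<notin> M (2 * r)"
        using True ab by (intro head1_notin) linarith
      moreover have "f r + (b - a) + (int r - 1) * d \<noteq> f (Suc r) - 2 * a"
        using ab rd unfolding fr by (simp add: algebra_simps)
      ultimately have "card ?V = 2 * r + 2" by (simp add: cardM finM)
      moreover have "card ?V \<le> n r"
      proof (rule le_n)
        show "?V \<subseteq> sign_deficits h x" using head1 head2 M_sub by simp
        have "M (2 * r) \<subseteq> {f r..<f (Suc r)}"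
          using M_le[of _ "2 * r"] ab d unfolding fr by (fastforce simp: algebra_simps)
        then show "?V \<subseteq> {f r..<f (Suc r)}" using heads_in by simp
      qed
      ultimately show ?thesis by simp
    next
      case False
      have M: "M (2 * r + 1) \<subseteq> {f r..<f (Suc r)}"
        using M_le[of _ "2 * r + 1"] False unfolding fr by (fastforce simp: algebra_simps)
      have ex: "2 * r + 2 \<le> n r" if "v \<in> sign_deficits h x" "v \<in> {f r..<f (Suc r)}" "v \<notin> M (2 * r + 1)" for v
        using le_n[of "insert v (M (2 * r + 1))" r] that M M_sub[of "2 * r + 1"] by (simp add: cardM finM)
      \<comment> \<open>All \<open>2 * r + 1\<close> terms fit, and one more member suffices. The
        one from \<open>head2\<close> is a term only if \<open>2 * (b - a) = d\<close>; in that case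
        \<open>b - a < d\<close>, so the one from \<open>head1\<close> is not a term.\<close>
      show ?thesis
      proof (cases "2 * (b - a) = d")
        case True
        show ?thesis
        proof (rule ex[OF head1])
          show "f r + (b - a) + (int r - 1) * d \<in> {f r..<f (Suc r)}" by (rule heads_in)
          show "f r + (b - a) + (int r - 1) * d \<notin> M (2 * r + 1)"
            by (rule head1_notin) (use True ab in simp)
        qed
      next
        case ne: False
        show ?thesis
        proof (rule ex[OF head2])
          show "f (Suc r) - 2 * a \<in> {f r..<f (Suc r)}" by (rule heads_in)
          show "f (Suc r) - 2 * a \<notin> M (2 * r + 1)"
          proof
            assume "f (Suc r) - 2 * a \<in> M (2 * r + 1)"
            then obtain i where i: "f (Suc r) - 2 * a = f r + int i * d" "i \<in> {..<2 * r + 1}"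
              unfolding M_def by (rule imageE)
            from i(1) have i2: "2 * (b - a) + (2 * int r - 1) * d = int i * d"
              unfolding fr by simp
            have "int i * d > (2 * int r - 1) * d" unfolding i2[symmetric] using ab by simp
            then have "i = 2 * r" using i(2) d by simp
            with i2 ne show False by (simp add: algebra_simps)
          qed
        qed
      qed
    qed
  qed

  \<comment> \<open>All indices except the omitted \<open>i\<close> are negative here;
    \<open>i = h\<close> gives the cut point \<open>f h\<close> itself.\<close>
  have n_top: "h + 1 \<le> card (sign_deficits h x \<inter> {f h..})"
  proof -
    have mono: "x i < x j" if "i < j" for i j
    proof (cases "i = 0")
      case True
      have "0 \<le> (int j - 1) * d" using that d by simp
      then show ?thesis using that ab True x0 xi[of j] by simp
    next
      case False
      then show ?thesis using that d by (simp add: xi)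
    qed
    have "inj_on (\<lambda>i. 2 * sum x {..h} - x i) {..h}"
      by (rule linorder_inj_onI) (use mono in \<open>force+\<close>)
    then have "h + 1 = card ((\<lambda>i. 2 * sum x {..h} - x i) ` {..h})"
      by (simp add: card_image)
    also have "\<dots> \<le> card (sign_deficits h x \<inter> {f h..})"
    proof (rule card_mono)
      have "x i \<le> x h" if "i \<le> h" for i
        using mono[of i h] that by (cases "i = h") auto
      then show "(\<lambda>i. 2 * sum x {..h} - x i) ` {..h} \<subseteq> sign_deficits h x \<inter> {f h..}"
        using sign_deficits_omit[of _ h h x] by (auto simp: f)
    qed (use finite_sign_deficits in simp)
    finally show ?thesis .
  qed

  have "(\<Sum>r<h. n r) + card (sign_deficits h x \<inter> {f h..}) = card (sign_deficits h x \<inter> {f 0..})"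
    unfolding n_def
    by (rule sum_card_atLeastLessThan_le[OF finite_sign_deficits]) (use pos f_Suc in \<open>simp add: less_imp_le\<close>)
  also have "\<dots> \<le> card (sign_deficits h x)" using finite_sign_deficits by (intro card_mono) auto
  finally have total: "(\<Sum>r<h. n r) + (h + 1) \<le> card (sign_deficits h x)"
    using n_top by linarith
  have "(\<Sum>r<h. n r) = n 0 + n 1 + (\<Sum>r\<in>{2..<h}. n r)"
    using h by (simp add: lessThan_atLeast0 sum.atLeast_Suc_lessThan numeral_2_eq_2)
  moreover have "(\<Sum>r\<in>{2..<h}. 2 * r + 2) \<le> (\<Sum>r\<in>{2..<h}. n r)"
    by (rule sum_mono) (use n_mid in auto)
  moreover have "(\<Sum>r\<in>{2..<h}. 2 * r + 2) + 6 + (h + 1) = (h + 1)\<^sup>2"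
  proof -
    have "(\<Sum>r\<in>{2..<h}. 2 * r + 2) + 6 = h * (h + 1)" if "2 \<le> h" for h :: nat
      using that by (induction h rule: dec_induct) (auto simp: algebra_simps)
    then show ?thesis using h by (simp add: power2_eq_square)
  qed
  ultimately have *: "(h + 1)\<^sup>2 + n 0 + n 1 \<le> card (sign_deficits h x) + 6"
    using total by linarith
  show "(h + 1)\<^sup>2 \<le> card (sign_deficits h x)" using * n0 n1 by linarith
  show "(h + 1)\<^sup>2 < card (sign_deficits h x)" if "b \<noteq> 3 * a \<or> d \<noteq> 2 * a"
    using * n0 n1_strict[OF that] by linarith
qed

section \<open>Sets with the minimal number of pairwise sums\<close>

text \<open>Any increasing sequence has \<open>2 * m - 3\<close> pair sums in the chain
  \<open>e\<close>, so \<open>D\<close> contains nothing else. Locating \<open>c 1 + c j\<close> in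
  the chain forces it to equal \<open>c 0 + c (Suc j)\<close>. The range starts at
  \<open>j = 2\<close> because \<open>c 1 + c 1\<close> is not a sum of two distinct terms.\<close>

lemma gaps_eq_of_few_pair_sums_aux:
  fixes c :: "nat \<Rightarrow> int"
  assumes m: "4 \<le> m" and c: "strict_mono_on {..<m} c"
    and D: "D = {c p + c q | p q. p < q \<and> q < m}" and card: "card D \<le> 2 * m - 3"
    and j: "2 \<le> j" "j \<le> m - 2"
  shows "c (Suc j) - c j = c 1 - c 0"
proof -
  have less: "c p < c q" if "p < q" "q < m" for p q
    using c that by (simp add: strict_mono_on_def)
  \<comment> \<open>The chain first raises the partner of \<open>c 0\<close> up to
    \<open>c (m - 1)\<close>, then raises the other summand from \<open>c 1\<close> (at
    \<open>p = m\<close>) to \<open>c (m - 2)\<close> (at \<open>p = 2 * m - 3\<close>).\<close>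
  define e where "e p = (if p < m then c 0 + c p else c (Suc p - m) + c (m - 1))" for p
  have e_less: "e p < e q" if "1 \<le> p" "p < q" "q \<le> 2 * m - 3" for p q
  proof -
    consider "q < m" | "p < m" "m \<le> q" | "m \<le> p" using that by linarith
    then show ?thesis
    proof cases
      case 1
      then show ?thesis using that less[of p q] by (simp add: e_def)
    next
      case 2
      have "c 0 < c (Suc q - m)" using that 2 m by (intro less) auto
      moreover have "c p \<le> c (m - 1)" using less[of p "m - 1"] 2 by (cases "p = m - 1") fastforce+
      ultimately show ?thesis using 2 by (simp add: e_def)
    next
      case 3
      have "c (Suc p - m) < c (Suc q - m)" using that 3 m by (intro less) auto
      then show ?thesis using 3 that by (simp add: e_def)
    qed
  qed
  have "finite D"
  proof -
    have "D \<subseteq> (\<lambda>(p, q). c p + c q) ` ({..<m} \<times> {..<m})" unfolding D by force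
    then show ?thesis by (rule finite_subset) simp
  qed
  moreover have "e ` {1..2 * m - 3} \<subseteq> D"
  proof clarify
    fix p assume p: "p \<in> {1..2 * m - 3}"
    show "e p \<in> D"
    proof (cases "p < m")
      case True
      then show ?thesis
        using p unfolding D by (intro CollectI exI[of _ 0] exI[of _ p]) (simp add: e_def)
    next
      case False
      then have "Suc p - m < m - 1" "m - 1 < m" using p m by auto
      then show ?thesis
        using False unfolding D
        by (intro CollectI exI[of _ "Suc p - m"] exI[of _ "m - 1"]) (simp add: e_def)
    qed
  qed
  moreover have "card (e ` {1..2 * m - 3}) = 2 * m - 3"
  proof -
    have "inj_on e {1..2 * m - 3}"
      by (rule linorder_inj_onI) (use e_less in \<open>force+\<close>)
    then show ?thesis by (simp add: card_image)
  qed
  ultimately have De: "D = e ` {1..2 * m - 3}"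
    using card by (metis card_seteq)
  text \<open>Both sides start at the common value \<open>c 1 + c (m - 1)\<close>, and going down \<open>e (i + 1)\<close> is the only
    element of \<open>D\<close> strictly between \<open>e i\<close> and \<open>e (i + 2)\<close>.\<close>
  have shift: "c 1 + c i = e (Suc i)" if "2 \<le> i" "i \<le> m - 1" for i
    using that(2,1)
  proof (induction i rule: inc_induct)
    case base
    then show ?case using m by (simp add: e_def)
  next
    case (step i)
    have "c 1 + c i \<in> D"
      unfolding D using step(1,2,4) by (intro CollectI exI[of _ 1] exI[of _ i]) simp
    then obtain p where p: "c 1 + c i = e p" "1 \<le> p" "p \<le> 2 * m - 3" unfolding De by auto
    have "e p < e (Suc (Suc i))"
      using step.IH step.hyps step.prems less[of i "Suc i"] unfolding p(1)[symmetric] by force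
    moreover have "e i < e p"
      using step.hyps(2) less[of 0 1] unfolding p(1)[symmetric] by (auto simp: e_def)
    ultimately have "\<not> p < i" "p \<noteq> i" "p \<noteq> Suc (Suc i)" "\<not> Suc (Suc i) < p"
      using e_less[of "Suc (Suc i)" p] e_less[of p i] p(2,3) step.hyps(2) step.prems by force+
    then have "p = Suc i" by linarith
    then show ?case using p by simp
  qed
  have "Suc j < m" "j \<le> m - 1" using j m by linarith+
  then show ?thesis using shift[of j] j by (simp add: e_def)
qed

text \<open>The auxiliary lemma misses the gap at \<open>j = 1\<close>. Applied to the reflected
  sequence \<open>c'\<close> it equates the gaps with \<open>j \<le> m - 4\<close> to the last one;
  since \<open>5 \<le> m\<close>, the two ranges together cover every gap, and gap 0 links
  them.\<close>

lemma gaps_eq_of_few_pair_sums: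
  fixes c :: "nat \<Rightarrow> int"
  assumes m: "5 \<le> m" and c: "strict_mono_on {..<m} c"
    and card: "card {c p + c q | p q. p < q \<and> q < m} \<le> 2 * m - 3"
    and j: "Suc j < m"
  shows "c (Suc j) - c j = c 1 - c 0"
proof -
  have up: "c (Suc i) - c i = c 1 - c 0" if "2 \<le> i" "i \<le> m - 2" for i
    using gaps_eq_of_few_pair_sums_aux[OF _ c refl card] that m by simp
  define c' where "c' i = - c (m - 1 - i)" for i
  have c': "strict_mono_on {..<m} c'"
    using c m unfolding strict_mono_on_def c'_def by auto
  have "{c' p + c' q | p q. p < q \<and> q < m} \<subseteq> uminus ` {c p + c q | p q. p < q \<and> q < m}"
  proof clarify
    fix p q :: nat assume pq: "p < q" "q < m"
    then have "m - 1 - q < m - 1 - p" "m - 1 - p < m" by auto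
    then have "c (m - 1 - q) + c (m - 1 - p) \<in> {c p + c q | p q. p < q \<and> q < m}" by blast
    then show "c' p + c' q \<in> uminus ` {c p + c q | p q. p < q \<and> q < m}"
      unfolding c'_def by (rule rev_image_eqI) simp
  qed
  moreover have "finite {c p + c q | p q. p < q \<and> q < m}"
    by (rule finite_subset[of _ "(\<lambda>(p, q). c p + c q) ` ({..<m} \<times> {..<m})"]) force+
  ultimately have "card {c' p + c' q | p q. p < q \<and> q < m} \<le> 2 * m - 3"
    using card by (meson surj_card_le le_trans)
  then have down: "c' (Suc i) - c' i = c' 1 - c' 0" if "2 \<le> i" "i \<le> m - 2" for i
    using gaps_eq_of_few_pair_sums_aux[OF _ c' refl] that m by simp
  have low: "c (Suc i) - c i = c (m - 1) - c (m - 2)" if "i \<le> m - 4" for i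
  proof -
    have "m - Suc (Suc (m - 2 - i)) = i" "m - Suc (m - 2 - i) = Suc i" using that m by auto
    then show ?thesis using down[of "m - 2 - i"] that m
      by (simp add: c'_def numeral_2_eq_2)
  qed
  have "c (m - 1) - c (m - 2) = c 1 - c 0"
    using low[of 0] by simp
  moreover have "j \<le> m - 4 \<or> 2 \<le> j" using m by linarith
  ultimately show ?thesis using low[of j] up[of j] j by fastforce
qed

section \<open>Progressions as sequences with constant gaps\<close>

text \<open>The term of the progression following \<open>a j\<close> belongs to the set and does not
  exceed \<open>a (Suc j)\<close>, so by monotonicity it is \<open>a (Suc j)\<close>.\<close>

lemma gaps_eq_of_arithmetic_progression:
  fixes a :: "nat \<Rightarrow> int"
  assumes "arithmetic_progression (a ` {p..q})" "strict_mono_on {p..q} a"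
  shows "\<exists>d>0. \<forall>j\<in>{p..<q}. a (Suc j) = a j + d"
proof -
  obtain c d n where d: "d > 0" and S: "a ` {p..q} = {c + int i * d | i. i < n}"
    using assms(1) unfolding arithmetic_progression_def by blast
  have less: "a i < a j" if "p \<le> i" "i < j" "j \<le> q" for i j
    using assms(2) that by (simp add: strict_mono_on_def)
  have "a (Suc j) = a j + d" if j: "p \<le> j" "j < q" for j
  proof -
    have "a j \<in> a ` {p..q}" "a (Suc j) \<in> a ` {p..q}" using j by auto
    then obtain u v where u: "a j = c + int u * d" and v: "a (Suc j) = c + int v * d" "v < n"
      unfolding S by blast
    have "int u * d < int v * d" using less[of j "Suc j"] j u v by simp
    then have "u < v" using d by simp
    have "c + int (Suc u) * d \<in> a ` {p..q}" unfolding S using \<open>u < v\<close> \<open>v < n\<close>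
      by (intro CollectI exI[of _ "Suc u"]) simp
    then obtain l where l: "p \<le> l" "l \<le> q" "a l = c + int (Suc u) * d" by auto
    have "a j < a l" using u l(3) d by (simp add: algebra_simps)
    then have "\<not> l \<le> j" using less[of l j] l(1) j by (cases "l = j") auto
    moreover have "a l \<le> a (Suc j)"
      using \<open>u < v\<close> d unfolding l(3) v by (intro add_left_mono mult_right_mono) auto
    then have "\<not> Suc j < l" using less[of "Suc j" l] l(2) j by auto
    ultimately have "l = Suc j" by simp
    then show ?thesis using u l(3) by (simp add: algebra_simps)
  qed
  with d show ?thesis by auto
qed

lemma eq_of_const_gaps:
  fixes a :: "nat \<Rightarrow> int"
  assumes "\<And>j. p \<le> j \<Longrightarrow> j < q \<Longrightarrow> a (Suc j) = a j + d" "p \<le> j" "j \<le> q"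
  shows "a j = a p + (int j - int p) * d"
  using assms(2,3)
proof (induction j rule: dec_induct)
  case (step j)
  then show ?case using assms(1)[of j] by (simp add: algebra_simps)
qed simp


section \<open>Windows of \<open>h\<close> consecutive elements and sharp cardinality bounds\<close>

lemma sum_window_Suc:
  fixes a :: "nat \<Rightarrow> int"
  shows "sum a {Suc (Suc i)..Suc i + h} = sum a {Suc i..i + h} + a (Suc i + h) - a (Suc i)"
proof (cases "h = 0")
  case False
  have "sum a {Suc i..Suc i + h} = sum a {Suc i..i + h} + a (Suc i + h)" by simp
  moreover have "sum a {Suc i..Suc i + h} = a (Suc i) + sum a {Suc (Suc i)..Suc i + h}"
    by (rule sum.atLeast_Suc_atMost) simp
  ultimately show ?thesis by simp
qed simp

lemma card_Int_atLeastAtMost_le: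
  fixes p q r :: int
  assumes "finite S"
  shows "card (S \<inter> {p..r}) \<le> Suc (card (S \<inter> {p<..q}) + card (S \<inter> {q<..r}))"
proof -
  let ?U = "(S \<inter> {p<..q}) \<union> (S \<inter> {q<..r})"
  have "card (S \<inter> {p..r}) \<le> card (insert p ?U)"
    by (rule card_mono) (use assms in auto)
  also have "\<dots> \<le> Suc (card ?U)"
    using assms by (simp add: card_insert_if)
  also have "card ?U \<le> card (S \<inter> {p<..q}) + card (S \<inter> {q<..r})"
    by (rule card_Un_le)
  finally show ?thesis by simp
qed

context
  fixes h k :: nat and a :: "nat \<Rightarrow> int" and t :: "nat \<Rightarrow> int" and S S\<^sub>h :: "int set"
  assumes h: "4 \<le> h" "h < k" and pos: "\<forall>i\<in>{1..k}. a i > 0"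
    and a_mono: "strict_mono_on {1..k} a"
  defines "t i \<equiv> sum a {Suc i..i + h}"
    and "S \<equiv> restricted_signed_sumset h (a ` {1..k})"
    and "S\<^sub>h \<equiv> restricted_signed_sumset h (a ` {1..h + 1})"
begin

lemma a_pos: "i \<in> {1..k} \<Longrightarrow> a i > 0"
  using pos by blast

lemma a_less: "1 \<le> i \<Longrightarrow> i < j \<Longrightarrow> j \<le> k \<Longrightarrow> a i < a j"
  using a_mono by (simp add: strict_mono_on_def)

lemma a_le: "1 \<le> i \<Longrightarrow> i \<le> j \<Longrightarrow> j \<le> k \<Longrightarrow> a i \<le> a j"
  using a_less[of i j] by (cases "i = j") auto

lemma inj_on_a: "inj_on a {1..k}"
  using a_mono by (rule strict_mono_on_imp_inj_on)

lemma t_Suc: "t (Suc i) = t i + a (Suc i + h) - a (Suc i)"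
  unfolding t_def by (rule sum_window_Suc)

lemma t_less_Suc: "i + h < k \<Longrightarrow> t i < t (Suc i)"
  using a_less[of "Suc i" "Suc i + h"] h by (simp add: t_Suc)

lemma finite_S: "finite S"
  unfolding S_def by (rule finite_restricted_signed_sumset)

lemma sum_mem_S: "X \<subseteq> {1..k} \<Longrightarrow> card X = h \<Longrightarrow> sum a X \<in> S"
  using restricted_signed_sumsetI[of "{1..k}" a X "{}" h] inj_on_a unfolding S_def by simp

text \<open>These are the sums over the indices \<open>Suc i\<close> to \<open>Suc i + h\<close>
  with one index \<open>j\<close> removed; \<open>j = Suc i\<close> gives the right endpoint. They
  are the \<open>h\<close> guaranteed members of the interval.\<close>

lemma sums_mem_S:
  assumes "i + h < k" "j \<in> {Suc i..i + h}"
  shows "t i + a (Suc i + h) - a j \<in> S \<inter> {t i<..t (Suc i)}"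
proof -
  have "sum a ({Suc i..Suc i + h} - {j}) = t i + a (Suc i + h) - a j"
    using assms by (simp add: sum_diff1 t_def)
  moreover have "sum a ({Suc i..Suc i + h} - {j}) \<in> S"
    using assms by (intro sum_mem_S) auto
  ultimately show ?thesis
    using a_less[of j "Suc i + h"] a_le[of "Suc i" j] assms by (simp add: t_Suc)
qed

lemma card_sums:
  assumes "i + h < k"
  shows "card ((\<lambda>j. t i + a (Suc i + h) - a j) ` {Suc i..i + h}) = h"
proof -
  have "inj_on a {Suc i..i + h}" by (rule inj_on_subset[OF inj_on_a]) (use assms in auto)
  then show ?thesis by (subst card_image) (auto simp: inj_on_def)
qed

lemma card_window_ge:
  assumes "i + h < k"
  shows "h \<le> card (S \<inter> {t i<..t (Suc i)})"
proof -
  have "(\<lambda>j. t i + a (Suc i + h) - a j) ` {Suc i..i + h} \<subseteq> S \<inter> {t i<..t (Suc i)}"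
    using sums_mem_S[OF assms] by blast
  from card_mono[OF _ this] show ?thesis using card_sums[OF assms] finite_S by simp
qed

lemma sum_initial: "sum a {1..h + 1} = t 1 + a 1"
  using sum.atLeast_Suc_atMost[of 1 "Suc h" a] by (simp add: t_def)

text \<open>The first \<open>h + 1\<close> elements add up to \<open>t 1 + a 1\<close>, and a signed
  sum omits one of them, which is at least \<open>a 1\<close>.\<close>

lemma S\<^sub>h_subset: "S\<^sub>h \<subseteq> S \<inter> {- t 1..t 1}"
proof
  fix s assume s: "s \<in> S\<^sub>h"
  have inj: "inj_on a {1..h + 1}" by (rule inj_on_subset[OF inj_on_a]) (use h in auto)
  have "\<bar>s\<bar> \<le> \<Sum>(a ` {1..h + 1}) - a 1"
  proof (rule abs_restricted_signed_sumset_le)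
    show "s \<in> restricted_signed_sumset h (a ` {1..h + 1})" using s unfolding S\<^sub>h_def .
    show "card (a ` {1..h + 1}) = h + 1" using inj by (simp add: card_image)
    show "0 \<le> a 1" using a_pos[of 1] h by simp
    show "a 1 \<le> v" if "v \<in> a ` {1..h + 1}" for v using that a_le[of 1] h by auto
  qed simp
  also have "\<Sum>(a ` {1..h + 1}) = t 1 + a 1"
    using inj sum_initial by (simp add: sum.reindex)
  finally have "\<bar>s\<bar> \<le> t 1" by simp
  moreover have "s \<in> S"
    using s restricted_signed_sumset_mono[of "a ` {1..k}" "a ` {1..h + 1}" h] h
      image_mono[of "{1..h + 1}" "{1..k}" a]
    unfolding S_def S\<^sub>h_def by fastforce
  ultimately show "s \<in> S \<inter> {- t 1..t 1}" by auto
qed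

lemma sum_card_windows:
  assumes "m + h \<le> k" "1 \<le> m"
  shows "(\<Sum>i\<in>{1..<m}. card (S \<inter> {t i<..t (Suc i)})) = card (S \<inter> {t 1<..t m})"
    and "t 1 \<le> t m"
  using assms(2,1)
proof (induction m rule: dec_induct)
  case (step m)
  {
    case 1
    have "t m < t (Suc m)" using 1 by (intro t_less_Suc) simp
    then have "S \<inter> {t 1<..t (Suc m)} = (S \<inter> {t 1<..t m}) \<union> (S \<inter> {t m<..t (Suc m)})"
      using step.IH(2) 1 by auto
    moreover have "(S \<inter> {t 1<..t m}) \<inter> (S \<inter> {t m<..t (Suc m)}) = {}" by auto
    ultimately have "card (S \<inter> {t 1<..t (Suc m)})
        = card (S \<inter> {t 1<..t m}) + card (S \<inter> {t m<..t (Suc m)})"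
      using finite_S by (simp add: card_Un_disjoint)
    then show ?case using step.IH(1) step.hyps 1 by simp
  next
    case 2
    then show ?case using step.IH(2) t_less_Suc[of m] by simp
  }
qed simp_all

text \<open>The central interval and the two outer ranges are disjoint, and the outer ones are
  mirror images. Their lower bounds add up to the assumed cardinality, so every one of them is
  attained.\<close>

lemma equality_structure:
  assumes card: "int (card S) = 2 * int h * int k - (int h)\<^sup>2 + 1"
    and card_h: "(h + 1)\<^sup>2 \<le> card S\<^sub>h"
  shows "card S\<^sub>h = (h + 1)\<^sup>2" "S \<inter> {- t 1..t 1} = S\<^sub>h"
    and "\<And>i. 1 \<le> i \<Longrightarrow> i + h < k \<Longrightarrow> card (S \<inter> {t i<..t (Suc i)}) = h"
proof -
  define m where "m = k - h"
  define w where "w i = card (S \<inter> {t i<..t (Suc i)})" for i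
  let ?in = "S \<inter> {- t 1..t 1}" and ?up = "S \<inter> {t 1<..t m}" and ?dn = "S \<inter> {- t m..<- t 1}"
  have m: "1 \<le> m" "m + h \<le> k" using h by (simp_all add: m_def)
  have t1: "0 \<le> t 1" unfolding t_def using a_pos h by (intro sum_nonneg) (auto simp: less_imp_le)
  have "uminus ` ?up = ?dn"
  proof
    show "?dn \<subseteq> uminus ` ?up"
    proof
      fix s assume "s \<in> ?dn"
      then have "- s \<in> ?up" using uminus_restricted_signed_sumset unfolding S_def by auto
      then show "s \<in> uminus ` ?up" by (rule rev_image_eqI) simp
    qed
    show "uminus ` ?up \<subseteq> ?dn"
      using uminus_restricted_signed_sumset unfolding S_def by auto
  qed
  then have dn: "card ?dn = card ?up" by (metis card_image inj_on_inverseI minus_minus)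
  have "card (?in \<union> ?up \<union> ?dn) = card ?in + card ?up + card ?dn"
    using finite_S t1 by (simp add: card_Un_disjoint disjoint_iff)
  moreover have "card (?in \<union> ?up \<union> ?dn) \<le> card S" using finite_S by (intro card_mono) auto
  ultimately have le: "card ?in + 2 * (\<Sum>i\<in>{1..<m}. w i) \<le> card S"
    using dn sum_card_windows[OF m(2,1)] by (simp add: w_def)
  have w: "h \<le> w i" if "i \<in> {1..<m}" for i
    using that card_window_ge[of i] by (auto simp: w_def m_def)
  then have sum_ge: "(m - 1) * h \<le> (\<Sum>i\<in>{1..<m}. w i)"
    using sum_bounded_below[of "{1..<m}" h w] by simp
  have in_ge: "card S\<^sub>h \<le> card ?in" using S\<^sub>h_subset finite_S by (intro card_mono) auto
  \<comment> \<open>With \<open>k = h + n + 1\<close> the assumed cardinality becomes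
    \<open>2 * n * h + (h + 1)\<^sup>2\<close>.\<close>
  obtain n where n: "m = Suc n" using m(1) by (cases m) auto
  then have "int k = int h + int n + 1" using h by (simp add: m_def)
  then have "int (card S) = int (2 * ((m - 1) * h) + (h + 1)\<^sup>2)"
    unfolding card n by (simp add: power2_eq_square algebra_simps)
  then have total: "card S = 2 * ((m - 1) * h) + (h + 1)\<^sup>2" by linarith
  show "card S\<^sub>h = (h + 1)\<^sup>2" using total le sum_ge in_ge card_h by linarith
  have "card ?in = card S\<^sub>h" using total le sum_ge in_ge card_h by linarith
  then show "?in = S\<^sub>h" using S\<^sub>h_subset finite_S by (metis card_subset_eq finite_Int)
  have "(\<Sum>i\<in>{1..<m}. w i) = (\<Sum>i\<in>{1..<m}. h)" using total le sum_ge in_ge card_h by simp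
  then have "w i = h" if "i \<in> {1..<m}" for i
    using sum_mono_inv[of "\<lambda>_. h" "{1..<m}" w i] w that by simp
  then show "card (S \<inter> {t i<..t (Suc i)}) = h" if "1 \<le> i" "i + h < k" for i
    using that by (simp add: w_def m_def)
qed

text \<open>Removing a pair from the \<open>h + 2\<close> elements after index \<open>i\<close>
  leaves an \<open>h\<close>-fold sum in \<open>[t i, t (i + 2)]\<close>. That interval holds at
  most \<open>h + h + 1 = 2 * (h + 2) - 3\<close> elements of \<open>S\<close>, the extra one being
  \<open>t i\<close>, so the pair sums are as few as possible.\<close>

lemma gap_eq:
  assumes exact: "\<And>i. 1 \<le> i \<Longrightarrow> i + h < k \<Longrightarrow> card (S \<inter> {t i<..t (Suc i)}) = h"
    and i: "1 \<le> i" "i + h + 2 \<le> k" and j: "j \<le> h"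
  shows "a (Suc (Suc i + j)) - a (Suc i + j) = a (Suc (Suc i)) - a (Suc i)"
proof -
  define c where "c p = a (Suc i + p)" for p
  let ?D = "{c p + c q | p q. p < q \<and> q < h + 2}"
  let ?W = "S \<inter> {t i..t (Suc (Suc i))}"
  let ?T = "sum a {Suc i..i + h + 2}"
  have c: "strict_mono_on {..<h + 2} c"
    unfolding strict_mono_on_def c_def using a_less i by auto
  have t2: "t (Suc (Suc i)) = t i + a (i + h + 2) + a (i + h + 1) - a (Suc (Suc i)) - a (Suc i)"
    by (simp add: t_Suc)
  have T: "?T = t i + a (i + h + 1) + a (i + h + 2)"
    by (simp add: t_def)
  have "(-) ?T ` ?D \<subseteq> ?W"
  proof clarify
    fix p q :: nat assume pq: "p < q" "q < h + 2"
    have sub: "{Suc i + p, Suc i + q} \<subseteq> {Suc i..i + h + 2}" using pq by auto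
    then have "sum a ({Suc i..i + h + 2} - {Suc i + p, Suc i + q}) = ?T - (c p + c q)"
      using pq unfolding c_def by (subst sum_diff) auto
    moreover have "card ({Suc i..i + h + 2} - {Suc i + p, Suc i + q}) = h"
      using sub pq by (subst card_Diff_subset) auto
    then have "sum a ({Suc i..i + h + 2} - {Suc i + p, Suc i + q}) \<in> S"
      using i by (intro sum_mem_S) auto
    ultimately have "?T - (c p + c q) \<in> S" by simp
    moreover have "a (Suc i) \<le> c p" "a (Suc (Suc i)) \<le> c q" "c p \<le> a (i + h + 1)" "c q \<le> a (i + h + 2)"
      using pq i unfolding c_def by (intro a_le; simp)+
    ultimately show "?T - (c p + c q) \<in> ?W"
      unfolding T t2 by simp
  qed
  then have "card ((-) ?T ` ?D) \<le> card ?W" using finite_S by (intro card_mono) auto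
  then have "card ?D \<le> card ?W" by (simp add: card_image)
  also have "card ?W \<le> Suc (card (S \<inter> {t i<..t (Suc i)}) + card (S \<inter> {t (Suc i)<..t (Suc (Suc i))}))"
    by (rule card_Int_atLeastAtMost_le[OF finite_S])
  also have "\<dots> = 2 * (h + 2) - 3"
    using exact[of i] exact[of "Suc i"] i by simp
  finally have few: "card ?D \<le> 2 * (h + 2) - 3" .
  have "c (Suc j) - c j = c 1 - c 0"
    by (rule gaps_eq_of_few_pair_sums[OF _ c few]) (use h j in simp_all)
  then show ?thesis by (simp add: c_def)
qed

lemma tail_gaps:
  assumes exact: "\<And>i. 1 \<le> i \<Longrightarrow> i + h < k \<Longrightarrow> card (S \<inter> {t i<..t (Suc i)}) = h"
    and k: "h + 3 \<le> k" and j: "2 \<le> j" "j < k"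
  shows "a (Suc j) = a j + (a 3 - a 2)"
  using j
proof (induction j rule: dec_induct)
  case (step j)
  \<comment> \<open>Both gaps to be compared must lie among the \<open>h + 2\<close> elements after
    index \<open>i\<close>; the cap \<open>k - h - 2\<close> keeps the last of these within
    \<open>k\<close>.\<close>
  define i where "i = min (j - 1) (k - h - 2)"
  have i: "1 \<le> i" "i + h + 2 \<le> k" "Suc i \<le> j" "Suc j \<le> Suc i + h"
    using step k h by (auto simp: i_def min_def)
  define p where "p = j - Suc i"
  have p: "j = Suc i + p" "p \<le> h" "Suc p \<le> h" using i by (simp_all add: p_def)
  have "a (Suc j) - a j = a (Suc (Suc i)) - a (Suc i)"
    using gap_eq[OF exact i(1,2) p(2)] unfolding p(1)[symmetric] .
  moreover have "a (Suc (Suc j)) - a (Suc j) = a (Suc (Suc i)) - a (Suc i)"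
    using gap_eq[OF exact i(1,2) p(3)] unfolding add_Suc_right p(1)[symmetric] .
  moreover have "a (Suc j) = a j + (a 3 - a 2)" using step by simp
  ultimately show ?case by linarith
qed (simp add: numeral_3_eq_3 numeral_2_eq_2)

text \<open>Transfers the count of deficits to the first \<open>h + 1\<close> elements, with
  \<open>a 1\<close> as head and \<open>a 2\<close> as the start of the progression.\<close>

lemma
  assumes d: "d > 0" and gaps: "\<And>j. 2 \<le> j \<Longrightarrow> j < h + 1 \<Longrightarrow> a (Suc j) = a j + d"
  shows card_S\<^sub>h_ge: "(h + 1)\<^sup>2 \<le> card S\<^sub>h"
    and head_determined: "card S\<^sub>h = (h + 1)\<^sup>2 \<Longrightarrow> a 2 = 3 * a 1 \<and> d = 2 * a 1"
proof -
  \<comment> \<open>Indices are shifted to start at 0, and the progression is continued beyond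
    \<open>h\<close> because the counting lemma speaks of all indices.\<close>
  define x where "x i = (if i = 0 then a 1 else a 2 + (int i - 1) * d)" for i
  have x_eq: "x i = a (Suc i)" if "i \<le> h" for i
  proof (cases "i = 0")
    case False
    then have "a (Suc i) = a 2 + (int (Suc i) - int 2) * d"
      using that by (intro eq_of_const_gaps[of 2 "h + 1" a d, OF gaps]) simp_all
    then show ?thesis using False by (simp add: x_def)
  qed (simp add: x_def)
  have "x ` {..h} = a ` Suc ` {..h}" unfolding image_image using x_eq by simp
  also have "Suc ` {..h} = {1..h + 1}" by (simp add: atMost_atLeast0 image_Suc_atLeastAtMost)
  finally have img: "x ` {..h} = a ` {1..h + 1}" .
  have inj: "inj_on x {..h}"
  proof (rule inj_onI)
    fix i j assume ij: "i \<in> {..h}" "j \<in> {..h}" "x i = x j"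
    then have "a (Suc i) = a (Suc j)" using x_eq by simp
    then have "Suc i = Suc j" by (rule inj_onD[OF inj_on_a]) (use ij h in simp_all)
    then show "i = j" by simp
  qed
  have le: "card (sign_deficits h x) \<le> card S\<^sub>h"
    using card_sign_deficits_le[OF inj] unfolding img S\<^sub>h_def .
  have a12: "0 < a 1" "a 1 < a 2" using a_pos[of 1] a_less[of 1 2] h by auto
  have x0: "x 0 = a 1" and xi: "\<And>i. 1 \<le> i \<Longrightarrow> x i = a 2 + (int i - 1) * d"
    by (simp_all add: x_def)
  note bounds = card_sign_deficits_head_and_progression[OF h(1) a12 d x0 xi]
  show "(h + 1)\<^sup>2 \<le> card S\<^sub>h"
    using bounds(1) le by (rule order_trans)
  show "a 2 = 3 * a 1 \<and> d = 2 * a 1" if "card S\<^sub>h = (h + 1)\<^sup>2"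
  proof (rule ccontr)
    assume "\<not> ?thesis"
    then have "(h + 1)\<^sup>2 < card (sign_deficits h x)" by (intro bounds(2)) blast+
    with le that show False by linarith
  qed
qed

text \<open>For \<open>k = h + 2\<close> there is a single interval above \<open>t 1\<close>, so the
  pair-sum argument has no two consecutive ones to work with. Instead one sum \<open>z\<close> is
  tested: a large last element would put \<open>z\<close> into the full interval above
  \<open>t 1\<close>, a small one would put it into \<open>S\<^sub>h\<close> with the wrong residue
  modulo \<open>2 * a 1\<close>.\<close>

lemma next_element:
  assumes odd: "\<And>j. 1 \<le> j \<Longrightarrow> j \<le> h + 1 \<Longrightarrow> a j = (2 * int j - 1) * a 1"
    and k: "h + 2 \<le> k" and inner: "S \<inter> {- t 1..t 1} = S\<^sub>h"
    and exact: "card (S \<inter> {t 1<..t 2}) = h"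
  shows "a (h + 2) = (2 * int h + 3) * a 1"
proof -
  let ?b = "a (h + 2)" and ?c = "(2 * int h + 3) * a 1"
  have a1: "0 < a 1" using a_pos[of 1] h by simp
  \<comment> \<open>This is \<open>t 1\<close> with \<open>a 2\<close> and \<open>a (h + 1)\<close>
    exchanged for \<open>a 1\<close> and \<open>a (h + 2)\<close>; the change is
    \<open>?b - ?c\<close> because \<open>a 2 + a (h + 1) - a 1 = ?c\<close>.\<close>
  define z where "z = t 1 + ?b - ?c"
  have "insert 1 (insert (h + 2) {3..h}) \<subseteq> {1..k}" "card (insert 1 (insert (h + 2) {3..h})) = h"
    using h k by auto
  then have "sum a (insert 1 (insert (h + 2) {3..h})) \<in> S" by (rule sum_mem_S)
  moreover have "{Suc 1..1 + h} = insert 2 (insert (h + 1) {3..h})" using h by auto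
  then have t1: "t 1 = a 2 + a (h + 1) + sum a {3..h}" using h by (simp add: t_def)
  moreover have "a 2 = 3 * a 1" "a (h + 1) = (2 * int h + 1) * a 1"
    using odd[of 2] odd[of "h + 1"] h by (simp_all add: algebra_simps)
  moreover have "sum a (insert 1 (insert (h + 2) {3..h})) = a 1 + ?b + sum a {3..h}"
    using h by simp
  ultimately have z: "z \<in> S" unfolding z_def by (simp add: algebra_simps)
  have a_last: "a (h + 1) < ?b" using a_less[of "h + 1" "h + 2"] k by simp
  have t2: "t 2 = t 1 + ?b - a 2" using t_Suc[of 1] by (simp add: numeral_2_eq_2)
  have "\<not> ?c < ?b"
  proof
    assume less: "?c < ?b"
    let ?V = "(\<lambda>j. t 1 + ?b - a j) ` {2..h + 1}"
    have V: "?V \<subseteq> S \<inter> {t 1<..t 2}" "card ?V = h"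
      using sums_mem_S[of 1] card_sums[of 1] k by (auto simp: numeral_2_eq_2)
    then have "?V = S \<inter> {t 1<..t 2}"
      using exact finite_S by (intro card_subset_eq) auto
    \<comment> \<open>This bound gives \<open>z \<le> t 2\<close>. As the sums in \<open>?V\<close>
      exhaust the interval, some \<open>a j\<close> with \<open>j \<le> h + 1\<close> would equal
      \<open>?c\<close>, which is too large.\<close>
    moreover have "a 2 \<le> ?c" using odd[of 2] h a1 by (simp add: mult_right_mono)
    then have "z \<in> S \<inter> {t 1<..t 2}" using z less unfolding t2 z_def by simp
    ultimately have "z \<in> ?V" by simp
    then obtain j where "z = t 1 + ?b - a j" "j \<in> {2..h + 1}" by (rule imageE)
    then have j: "2 \<le> j" "j \<le> h + 1" "a j = ?c" unfolding z_def by simp_all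
    then have "(2 * int j - 1) * a 1 = (2 * int h + 3) * a 1" using odd[of j] by simp
    then show False using a1 j by simp
  qed
  moreover have "\<not> ?b < ?c"
  proof
    assume less: "?b < ?c"
    have S\<^sub>h_cong: "2 * a 1 dvd s - a 1 * int h" if "s \<in> S\<^sub>h" for s
    proof (rule restricted_signed_sumset_odd_multiples)
      show "s \<in> restricted_signed_sumset h (a ` {1..h + 1})" using that unfolding S\<^sub>h_def .
      show "\<exists>n. v = (2 * n - 1) * a 1" if "v \<in> a ` {1..h + 1}" for v
      proof -
        from that obtain j where "v = a j" "j \<in> {1..h + 1}" by (rule imageE)
        then have "v = (2 * int j - 1) * a 1" using odd[of j] by simp
        then show ?thesis by blast
      qed
    qed
    have nonneg: "0 \<le> sum a {3..h}" using a_pos k by (intro sum_nonneg) (auto simp: less_imp_le)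
    \<comment> \<open>Since \<open>a (h + 1) = ?c - 2 * a 1\<close>, the difference
      \<open>?c - ?b\<close> lies strictly between 0 and the modulus.\<close>
    have gap: "?c - 2 * a 1 < ?b"
      using a_last odd[of "h + 1"] by (simp add: algebra_simps)
    have "2 * a 1 \<le> t 1"
      using a_le[of 1 2] a_le[of 1 "h + 1"] k nonneg t1 by simp
    then have "z \<in> S\<^sub>h" "t 1 \<in> S\<^sub>h"
      using z less gap a1 sum_mem_S[of "{Suc 1..1 + h}"] k unfolding inner[symmetric] z_def
      by (auto simp: t_def)
    then have "2 * a 1 dvd (t 1 - a 1 * int h) - (z - a 1 * int h)"
      by (intro dvd_diff S\<^sub>h_cong)
    then have "2 * a 1 dvd ?c - ?b" by (simp add: z_def)
    then show False using less gap zdvd_not_zless[of "?c - ?b" "2 * a 1"] by simp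
  qed
  ultimately show ?thesis by simp
qed

end

section \<open>Assembling the five cases\<close>

theorem theorem2p7:
  fixes h k :: nat and a :: "nat \<Rightarrow> int" and A A\<^sub>h A' :: "int set"
  assumes "4 \<le> h" and "h \<le> k - 1"
    and "\<And>i. i \<in> {1..k} \<Longrightarrow> a i > 0"
    and "strict_mono_on {1..k} a"
    and "A = a ` {1..k}"
    and "A\<^sub>h = a ` {1..h + 1}"
    and "A' = A - {a 1}"
    and "int (card (restricted_signed_sumset h A)) = 2 * int h * int k - (int h)\<^sup>2 + 1"
    and "arithmetic_progression A
       \<or> arithmetic_progression A\<^sub>h
       \<or> (card (restricted_signed_sumset h A\<^sub>h) \<ge> (h + 1)\<^sup>2 \<and> 4 \<le> h \<and> h \<le> k - 3)
       \<or> (restricted_signed_sumset h A =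
            restricted_sumset h (uminus ` A') \<union> restricted_signed_sumset h A\<^sub>h \<union> restricted_sumset h A'
          \<and> arithmetic_progression A')
       \<or> (card (restricted_signed_sumset h A\<^sub>h) \<ge> (h + 1)\<^sup>2 \<and> arithmetic_progression A')"
  shows "A = dilate (a 1) {2 * int i - 1 | i. i \<in> {1..k}}"
proof -
  define S where "S = restricted_signed_sumset h A"
  define S\<^sub>h where "S\<^sub>h = restricted_signed_sumset h A\<^sub>h"
  define t where "t i = sum a {Suc i..i + h}" for i
  have hk: "4 \<le> h" "h < k" using assms(1,2) by auto
  have pos: "\<forall>i\<in>{1..k}. a i > 0" using assms(3) by blast
  note ctx = hk pos assms(4)
  note S_eq = S_def[unfolded assms(5)] and S\<^sub>h_eq = S\<^sub>h_def[unfolded assms(6)]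
  have card_S: "int (card S) = 2 * int h * int k - (int h)\<^sup>2 + 1"
    unfolding S_def by (rule assms(8))
  have A': "A' = a ` {2..k}"
  proof -
    have "{1..k} - {1} = {2..k}" by auto
    then show ?thesis
      using inj_on_image_set_diff[OF inj_on_a[OF ctx], of "{1..k}" "{1}"] hk
      unfolding assms(5,7) by simp
  qed
  have goal_if: ?thesis if "\<And>j. 1 \<le> j \<Longrightarrow> j \<le> k \<Longrightarrow> a j = (2 * int j - 1) * a 1"
  proof -
    have "A = (\<lambda>j. a 1 * (2 * int j - 1)) ` {1..k}"
      unfolding assms(5)
    proof (rule image_cong)
      fix j assume "j \<in> {1..k}"
      then have "a j = (2 * int j - 1) * a 1" by (intro that) simp_all
      then show "a j = a 1 * (2 * int j - 1)" by (simp only: mult.commute)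
    qed simp
    then show ?thesis unfolding dilate_def by auto
  qed
  note equality = equality_structure[OF ctx, folded t_def, folded S_eq S\<^sub>h_eq, OF card_S]
  \<comment> \<open>Constant gaps from \<open>a 2\<close> on give both the lower bound and, by
    sharpness, the exact count for the first \<open>h + 1\<close> elements; this fixes the head and
    the difference.\<close>
  have main: ?thesis
    if d: "d > 0" and gaps: "\<And>j. 2 \<le> j \<Longrightarrow> j < k \<Longrightarrow> a (Suc j) = a j + d" for d
  proof (rule goal_if)
    fix j assume j: "1 \<le> j" "j \<le> k"
    have "(h + 1)\<^sup>2 \<le> card S\<^sub>h"
      unfolding S\<^sub>h_eq by (rule card_S\<^sub>h_ge[OF ctx d]) (use gaps hk in simp)
    then have "card S\<^sub>h = (h + 1)\<^sup>2" by (rule equality(1))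
    then have "a 2 = 3 * a 1 \<and> d = 2 * a 1"
      unfolding S\<^sub>h_eq by (intro head_determined[OF ctx d]) (use gaps hk in simp_all)
    moreover have "a j = a 2 + (int j - int 2) * d" if "2 \<le> j"
      using that j by (intro eq_of_const_gaps[of 2 k a d, OF gaps])
    ultimately show "a j = (2 * int j - 1) * a 1"
      using j by (cases "j = 1") (simp_all add: algebra_simps)
  qed
  \<comment> \<open>From \<open>h + 3 \<le> k\<close> on there are two consecutive sharp intervals,
    so constant gaps from \<open>a 2\<close> on follow from sharpness.\<close>
  have large: ?thesis if c: "(h + 1)\<^sup>2 \<le> card S\<^sub>h" and k3: "h + 3 \<le> k"
  proof (rule main)
    show "a 3 - a 2 > 0" using a_less[OF ctx, of 2 3] hk by simp
    show "a (Suc j) = a j + (a 3 - a 2)" if "2 \<le> j" "j < k" for j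
      by (rule tail_gaps[OF ctx, folded t_def, folded S_eq]) (use equality(3)[OF c] k3 that in auto)
  qed
  have tail_ap: ?thesis if ap: "arithmetic_progression A'"
  proof -
    have "strict_mono_on {2..k} a"
      using assms(4) by (simp add: strict_mono_on_def)
    then obtain d where d: "d > 0" and gaps: "\<forall>j\<in>{2..<k}. a (Suc j) = a j + d"
      using gaps_eq_of_arithmetic_progression[OF ap[unfolded A']] by blast
    show ?thesis by (rule main[OF d]) (use gaps in simp)
  qed
  have head_ap: ?thesis if ap: "arithmetic_progression A\<^sub>h"
  proof -
    have "strict_mono_on {1..h + 1} a"
      using assms(4) hk by (simp add: strict_mono_on_def)
    then obtain d where d: "d > 0" and ball: "\<forall>j\<in>{1..<h + 1}. a (Suc j) = a j + d"
      using gaps_eq_of_arithmetic_progression[OF ap[unfolded assms(6)]] by blast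
    then have gaps: "a (Suc j) = a j + d" if "1 \<le> j" "j < h + 1" for j using that by simp
    have c: "(h + 1)\<^sup>2 \<le> card S\<^sub>h"
      unfolding S\<^sub>h_eq by (rule card_S\<^sub>h_ge[OF ctx d]) (use gaps in simp)
    then have "card S\<^sub>h = (h + 1)\<^sup>2" by (rule equality(1))
    then have "a 2 = 3 * a 1 \<and> d = 2 * a 1"
      unfolding S\<^sub>h_eq by (intro head_determined[OF ctx d]) (use gaps in simp_all)
    then have odd: "a j = (2 * int j - 1) * a 1" if "1 \<le> j" "j \<le> h + 1" for j
    proof -
      have "a j = a 1 + (int j - int 1) * d"
        using that by (intro eq_of_const_gaps[of 1 "h + 1" a d, OF gaps])
      with \<open>a 2 = 3 * a 1 \<and> d = 2 * a 1\<close> show ?thesis by (simp add: algebra_simps)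
    qed
    \<comment> \<open>The first \<open>h + 1\<close> elements are now known: they are all of
      \<open>A\<close>, or one element remains, or two consecutive intervals are available.\<close>
    consider "k = h + 1" | "k = h + 2" | "h + 3 \<le> k" using hk by linarith
    then show ?thesis
    proof cases
      case 1
      show ?thesis by (rule goal_if, rule odd) (use 1 in simp_all)
    next
      case 2
      have "a (h + 2) = (2 * int h + 3) * a 1"
      proof (rule next_element[OF ctx, folded t_def, folded S_eq S\<^sub>h_eq])
        show "a j = (2 * int j - 1) * a 1" if "1 \<le> j" "j \<le> h + 1" for j
          using that by (rule odd)
        show "S \<inter> {- t 1..t 1} = S\<^sub>h" by (rule equality(2)[OF c])
        show "card (S \<inter> {t 1<..t 2}) = h"
          using equality(3)[OF c, of 1] 2 by (simp add: numeral_2_eq_2)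
      qed (use 2 in simp)
      then have "a j = (2 * int j - 1) * a 1" if "1 \<le> j" "j \<le> k" for j
      proof (cases "j = h + 2")
        case False
        then show ?thesis using that 2 by (intro odd) simp_all
      qed simp
      then show ?thesis by (rule goal_if)
    next
      case 3
      with c show ?thesis by (rule large)
    qed
  qed
  have full_ap: ?thesis if ap: "arithmetic_progression A"
  proof -
    obtain d where d: "d > 0" and gaps: "\<forall>j\<in>{1..<k}. a (Suc j) = a j + d"
      using gaps_eq_of_arithmetic_progression[OF ap[unfolded assms(5)] assms(4)] by blast
    show ?thesis by (rule main[OF d]) (use gaps in simp)
  qed
  \<comment> \<open>The subtraction of naturals is harmless, as \<open>4 \<le> h\<close> makes
    \<open>k - 3\<close> positive.\<close>
  have "h + 3 \<le> k" if "h \<le> k - 3" using that hk by linarith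
  then show ?thesis using assms(9) full_ap head_ap large tail_ap unfolding S\<^sub>h_def by blast
qed

end
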